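(* Let $G$ be a connected graph on $n$ vertices with adjacency matrix $A$, and suppose that $G$ belongs to a homogeneous coherent configuration $\{I = A_0, A_1, \dotsc, A_d\}$ of $n\times n$ matrices. Let $\mathcal{A}$ be the coherent algebra spanned over $\mathbb{C}$ by $A_0,\dotsc,A_d$, and for a matrix $X$ let $X'$ denote the orthogonal projection of $X$ onto $\mathcal{A}$. Put $\overline{A} = J - I - A$. Let $M$ and $N$ be non-zero positive semidefinite $n\times n$ matrices satisfying at least one of the following two conditions: (A) $M \circ A = 0$ and $N \circ \overline{A} = 0$; (B) $M \circ A \leq 0$, $N \circ \overline{A} = 0$ and $N \circ A \geq 0$. Then $$n \geq \frac{(\operatorname{tr} JM)(\operatorname{tr} JN)}{(\operatorname{tr} M)(\operatorname{tr} N)}.$$ Moreover, equality holds if and only if $M'N'$ is a scalar multiple of $J$, and either (A) holds, or (B) holds in such a way that $\langle M, A_r\rangle\langle A_r, N\rangle = 0$ for all $r \neq 0$.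
   Context: Graphs are finite, simple and undirected. Matrices are complex $n\times n$ matrices, $I$ is the identity matrix, $J$ is the all-ones matrix, $M^*$ is the conjugate transpose, and $\langle M, N\rangle = \operatorname{tr}(MN^* )$; orthogonality refers to this inner product. Positive semidefinite means Hermitian positive semidefinite. $B\circ C$ is the Schur (entrywise) product, and $B \le 0$, $B\ge 0$ are entrywise inequalities (in particular the entries of $B$ are real). A coherent configuration is a finite set of $01$ matrices $\{A_0,\dotsc,A_d\}$ such that: (i) $\sum_{i=0}^d A_i = J$; (ii) for each $i$, if some diagonal entry of $A_i$ is non-zero, then $A_i$ is diagonal; (iii) the set is closed under transposition; (iv) for all $i,j$, $A_iA_j$ is a linear combination of the matrices in the configuration. It is homogeneous if the identity matrix is one of its matrices. The coherent algebra is the complex algebra generated by (equivalently, the linear span of) the matrices of the configuration. A graph belongs to a coherent configuration if its adjacency matrix is a sum of (distinct) matrices of the configuration. *)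

theory Defs
  imports "HOL-Analysis.Analysis" "Graph_Theory.Pair_Digraph" "Graph_Theory.Digraph_Component"
begin

text \<open>
  Inequalities between complex numbers are those of \<^theory>\<open>HOL-Library.Complex_Order\<close>:
  \<open>x \<le> y\<close> means \<open>Re x \<le> Re y\<close> and \<open>Im x = Im y\<close>, so \<open>x \<le> 0\<close> and \<open>0 \<le> x\<close>
  entail that \<open>x\<close> is real. The order on vectors, hence on matrices, is componentwise.
\<close>

definition mscale :: "complex \<Rightarrow> complex^'n^'n \<Rightarrow> complex^'n^'n" where
  "mscale c M = (\<chi> i j. c * M $ i $ j)"

global_interpretation cmat: vector_space mscale
  by unfold_locales (simp_all add: mscale_def vec_eq_iff algebra_simps)

definition all_ones :: "complex^'n^'n" where
  "all_ones = (\<chi> i j. 1)"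

definition conj_transpose :: "complex^'n^'n \<Rightarrow> complex^'n^'n" where
  "conj_transpose M = (\<chi> i j. cnj (M $ j $ i))"

definition schur_product :: "complex^'n^'n \<Rightarrow> complex^'n^'n \<Rightarrow> complex^'n^'n"
    (infixl \<open>\<odot>\<close> 70) where
  "M \<odot> N = (\<chi> i j. M $ i $ j * N $ i $ j)"

text \<open>
  The library's real inner product on \<open>complex^'n^'n\<close> is only the real part of this one.
\<close>

definition mat_inner :: "complex^'n^'n \<Rightarrow> complex^'n^'n \<Rightarrow> complex" where
  "mat_inner M N = trace (M ** conj_transpose N)"

definition psd :: "complex^'n^'n \<Rightarrow> bool" where
  "psd M \<longleftrightarrow> conj_transpose M = M \<and>
     (\<forall>x :: complex^'n. 0 \<le> (\<Sum>i\<in>UNIV. \<Sum>j\<in>UNIV. cnj (x $ i) * M $ i $ j * x $ j))"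

definition zero_one_matrix :: "complex^'n^'n \<Rightarrow> bool" where
  "zero_one_matrix M \<longleftrightarrow> (\<forall>i j. M $ i $ j \<in> {0, 1})"

definition diagonal_matrix :: "complex^'n^'n \<Rightarrow> bool" where
  "diagonal_matrix M \<longleftrightarrow> (\<forall>i j. i \<noteq> j \<longrightarrow> M $ i $ j = 0)"

definition coherent_configuration :: "(complex^'n^'n) set \<Rightarrow> bool" where
  "coherent_configuration \<C> \<longleftrightarrow>
     finite \<C> \<and> (\<forall>B\<in>\<C>. zero_one_matrix B) \<and>
     \<Sum>\<C> = all_ones \<and>
     (\<forall>B\<in>\<C>. (\<exists>i. B $ i $ i \<noteq> 0) \<longrightarrow> diagonal_matrix B) \<and>
     (\<forall>B\<in>\<C>. transpose B \<in> \<C>) \<and>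
     (\<forall>B\<in>\<C>. \<forall>C\<in>\<C>. B ** C \<in> cmat.span \<C>)"

definition homogeneous :: "(complex^'n^'n) set \<Rightarrow> bool" where
  "homogeneous \<C> \<longleftrightarrow> mat 1 \<in> \<C>"

definition coherent_algebra :: "(complex^'n^'n) set \<Rightarrow> (complex^'n^'n) set" where
  "coherent_algebra \<C> = cmat.span \<C>"

definition orth_proj :: "(complex^'n^'n) set \<Rightarrow> complex^'n^'n \<Rightarrow> complex^'n^'n" where
  "orth_proj \<A> X = (THE Y. Y \<in> \<A> \<and> (\<forall>Z\<in>\<A>. mat_inner (X - Y) Z = 0))"

text \<open>
  A finite simple undirected graph is a \<^locale>\<open>pair_graph\<close>, in which an edge is a pair of
  opposite arcs; matrices are indexed by the vertex type.
\<close>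

definition adjacency_matrix :: "'n::finite pair_pre_digraph \<Rightarrow> complex^'n^'n" where
  "adjacency_matrix G = (\<chi> u v. if (u, v) \<in> parcs G then 1 else 0)"

definition belongs_to :: "'n::finite pair_pre_digraph \<Rightarrow> (complex^'n^'n) set \<Rightarrow> bool" where
  "belongs_to G \<C> \<longleftrightarrow> (\<exists>\<S>\<subseteq>\<C>. adjacency_matrix G = \<Sum>\<S>)"


text \<open>The orthogonal projection onto a coherent algebra is well defined.\<close>

lemma mat_inner_sum: "mat_inner M N = (\<Sum>i\<in>UNIV. \<Sum>j\<in>UNIV. M $ i $ j * cnj (N $ i $ j))"
  by (simp add: mat_inner_def trace_def matrix_matrix_mult_def conj_transpose_def)

lemma mat_inner_simps:
  "mat_inner 0 N = 0" "mat_inner M 0 = 0"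
  "mat_inner (M + M') N = mat_inner M N + mat_inner M' N"
  "mat_inner (M - M') N = mat_inner M N - mat_inner M' N"
  "mat_inner M (N + N') = mat_inner M N + mat_inner M N'"
  "mat_inner (mscale c M) N = c * mat_inner M N"
  "mat_inner M (mscale c N) = cnj c * mat_inner M N"
  by (simp_all add: mat_inner_sum mscale_def sum.distrib sum_subtractf sum_distrib_left algebra_simps)

lemma mat_inner_sum_left: "mat_inner (\<Sum>i\<in>I. f i) N = (\<Sum>i\<in>I. mat_inner (f i) N)"
  by (induction I rule: infinite_finite_induct) (simp_all add: mat_inner_simps)

lemma mat_inner_eq_0_iff: "mat_inner M M = 0 \<longleftrightarrow> M = 0"
proof
  assume "mat_inner M M = 0"
  then have "of_real (\<Sum>i\<in>UNIV. \<Sum>j\<in>UNIV. (cmod (M $ i $ j))\<^sup>2) = (0::complex)"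
    by (simp add: mat_inner_sum complex_norm_square del: of_real_power)
  then have "(\<Sum>i\<in>UNIV. \<Sum>j\<in>UNIV. (cmod (M $ i $ j))\<^sup>2) = 0"
    using of_real_eq_0_iff by blast
  then show "M = 0"
    by (simp add: sum_nonneg_eq_0_iff sum_nonneg vec_eq_iff)
qed (simp add: mat_inner_simps)

lemma coherent_configuration_orthogonal:
  assumes "coherent_configuration \<C>" "B \<in> \<C>" "C \<in> \<C>" "B \<noteq> C"
  shows "mat_inner B C = 0"
proof -
  have fin: "finite \<C>" and entries: "\<And>B i j. B \<in> \<C> \<Longrightarrow> B $ i $ j \<in> {0, 1}"
    and J: "\<Sum>\<C> = all_ones"
    using assms(1) by (auto simp: coherent_configuration_def zero_one_matrix_def)
  have "B $ i $ j * cnj (C $ i $ j) = 0" for i j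
  proof (rule ccontr)
    assume "B $ i $ j * cnj (C $ i $ j) \<noteq> 0"
    then have "B $ i $ j = 1" "C $ i $ j = 1"
      using entries[OF assms(2), of i j] entries[OF assms(3), of i j] by auto
    moreover have "(\<Sum>D\<in>{B, C}. Re (D $ i $ j)) \<le> (\<Sum>D\<in>\<C>. Re (D $ i $ j))"
    proof (rule sum_mono2[OF fin])
      show "0 \<le> Re (D $ i $ j)" if "D \<in> \<C> - {B, C}" for D
        using entries[of D i j] that by auto
    qed (use assms in auto)
    moreover have "(\<Sum>D\<in>\<C>. Re (D $ i $ j)) = Re ((\<Sum>\<C>) $ i $ j)"
      by (simp add: sum_component)
    ultimately show False
      using assms(4) by (simp add: J all_ones_def)
  qed
  then show ?thesis
    unfolding mat_inner_sum by (intro sum.neutral ballI)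
qed

lemma ex1_orth_proj:
  assumes "coherent_configuration \<C>"
  shows "\<exists>!Y. Y \<in> coherent_algebra \<C> \<and> (\<forall>Z\<in>coherent_algebra \<C>. mat_inner (X - Y) Z = 0)"
proof (rule ex_ex1I)
  let ?Y = "\<Sum>B\<in>\<C>. mscale (mat_inner X B / mat_inner B B) B"
  have fin: "finite \<C>"
    using assms by (simp add: coherent_configuration_def)
  have base: "mat_inner (X - ?Y) C = 0" if "C \<in> \<C>" for C
  proof -
    have "mat_inner ?Y C = (\<Sum>B\<in>\<C>. mat_inner X B / mat_inner B B * mat_inner B C)"
      by (simp add: mat_inner_sum_left mat_inner_simps)
    also have "\<dots> = (\<Sum>B\<in>\<C>. if B = C then mat_inner X C else 0)"
      using that coherent_configuration_orthogonal[OF assms]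
      by (intro sum.cong) (auto simp: mat_inner_eq_0_iff mat_inner_simps)
    finally show ?thesis
      using fin that by (simp add: mat_inner_simps)
  qed
  have "mat_inner (X - ?Y) Z = 0" if "Z \<in> cmat.span \<C>" for Z
    using that
    by (induction rule: cmat.span_induct_alt) (simp_all add: mat_inner_simps(2,5,7) base)
  moreover have "?Y \<in> cmat.span \<C>"
    by (intro cmat.span_sum cmat.span_scale cmat.span_base)
  ultimately show "\<exists>Y. Y \<in> coherent_algebra \<C> \<and> (\<forall>Z\<in>coherent_algebra \<C>. mat_inner (X - Y) Z = 0)"
    unfolding coherent_algebra_def by blast
next
  fix Y Y'
  assume Y: "Y \<in> coherent_algebra \<C> \<and> (\<forall>Z\<in>coherent_algebra \<C>. mat_inner (X - Y) Z = 0)"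
    and Y': "Y' \<in> coherent_algebra \<C> \<and> (\<forall>Z\<in>coherent_algebra \<C>. mat_inner (X - Y') Z = 0)"
  then have "Y - Y' \<in> coherent_algebra \<C>"
    by (simp add: coherent_algebra_def cmat.span_diff)
  with Y Y' have "mat_inner (X - Y') (Y - Y') - mat_inner (X - Y) (Y - Y') = 0"
    by simp
  then have "mat_inner (Y - Y') (Y - Y') = 0"
    by (simp add: mat_inner_simps(4))
  then show "Y = Y'"
    by (simp add: mat_inner_eq_0_iff)
qed

end

theory Submission
  imports Defs
begin

text \<open>
  The proof evaluates \<open>\<langle>M', N'\<rangle> = tr (M' N')\<close> in two ways, as in the clique-coclique bound.

  Expanding in the orthogonal family of the configuration (\<open>mat_inner_orth_proj\<close>) gives the sum
  of \<open>\<langle>M, A\<^sub>r\<rangle> \<langle>A\<^sub>r, N\<rangle> / \<langle>A\<^sub>r, A\<^sub>r\<rangle>\<close>. The identity contributes \<open>tr M tr N / n\<close>. For \<open>r \<noteq> 0\<close>, the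
  class \<open>A\<^sub>r\<close> lies either in the graph or in its complement: in the complement
  \<open>\<langle>A\<^sub>r, N\<rangle> = 0\<close>, and in the graph \<open>\<langle>M, A\<^sub>r\<rangle>\<close> vanishes under (A), or is nonpositive with
  \<open>\<langle>A\<^sub>r, N\<rangle>\<close> nonnegative under (B). So \<open>tr (M' N') \<le> tr M tr N / n\<close>, with equality exactly if
  all terms with \<open>r \<noteq> 0\<close> vanish.

  From below, projecting onto the algebra preserves positive semidefiniteness
  (\<open>orth_proj_psd\<close>) as well as the inner products with \<open>I\<close> and \<open>J\<close>. By homogeneity all elements
  of the algebra have constant row and column sums (\<open>algebra_mult_all_ones\<close>), so the all-ones
  vector is a common eigenvector of \<open>M'\<close> and \<open>N'\<close> and contributes
  \<open>tr (J M) tr (J N) / n\<^sup>2\<close> to \<open>tr (M' N')\<close>. What remains is the trace of a product of two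
  positive semidefinite matrices, which is nonnegative and vanishes only if the product itself
  does (\<open>psd_trace_mult\<close>); that happens exactly if \<open>M' N'\<close> is a multiple of \<open>J\<close>
  (\<open>psd_algebra_trace_mult\<close>). Comparing the two estimates gives the bound, and equality holds
  exactly if it holds in both.

  Instead of the spectral theorem, the proof of \<open>orth_proj_psd\<close> uses the least eigenvalue
  \<open>\<theta>\<close> of a Hermitian matrix \<open>H\<close> in the algebra and a matrix \<open>X \<noteq> 0\<close> of the algebra with
  \<open>H X = \<theta> X\<close> (\<open>eigenvalue_in_subalgebra\<close>).
\<close>

section \<open>Hermitian form and matrix arithmetic\<close>

definition cdot :: "complex^'n \<Rightarrow> complex^'n \<Rightarrow> complex" where
  "cdot x y = (\<Sum>i\<in>UNIV. cnj (x $ i) * y $ i)"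

lemma cdot_simps:
  "cdot (x - x') y = cdot x y - cdot x' y"
  "cdot x (y - y') = cdot x y - cdot x y'"
  "cdot (c *s x) y = cnj c * cdot x y"
  "cdot x (c *s y) = c * cdot x y"
  "cdot x 0 = 0" "cdot 0 x = 0"
  by (simp_all add: cdot_def sum.distrib sum_subtractf sum_distrib_left algebra_simps)

lemma cnj_cdot: "cnj (cdot x y) = cdot y x"
  by (simp add: cdot_def mult.commute)

lemma cdot_adjoint: "cdot x (M *v y) = cdot (conj_transpose M *v x) y"
proof -
  have "cdot x (M *v y) = (\<Sum>i\<in>UNIV. \<Sum>j\<in>UNIV. cnj (x $ i) * (M $ i $ j * y $ j))"
    by (simp add: cdot_def matrix_vector_mult_def sum_distrib_left)
  also have "\<dots> = (\<Sum>j\<in>UNIV. \<Sum>i\<in>UNIV. cnj (x $ i) * (M $ i $ j * y $ j))"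
    by (rule sum.swap)
  finally show ?thesis
    by (simp add: cdot_def matrix_vector_mult_def conj_transpose_def sum_distrib_left sum_distrib_right ac_simps)
qed

lemma cdot_self: "cdot x x = of_real ((norm x)\<^sup>2)"
proof -
  have "(norm x)\<^sup>2 = (\<Sum>i\<in>UNIV. (cmod (x $ i))\<^sup>2)"
    by (simp add: norm_vec_def L2_set_def sum_nonneg)
  then show ?thesis
    by (simp add: cdot_def complex_norm_square mult.commute del: of_real_power)
qed

lemma psd_iff_cdot: "psd M \<longleftrightarrow> conj_transpose M = M \<and> (\<forall>x. 0 \<le> cdot x (M *v x))"
  by (simp add: psd_def cdot_def matrix_vector_mult_def sum_distrib_left mult.assoc)

lemma psd_hermitian: "psd M \<Longrightarrow> conj_transpose M = M"
  and psd_cdot_nonneg: "psd M \<Longrightarrow> 0 \<le> cdot x (M *v x)"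
  by (simp_all add: psd_iff_cdot)

lemma conj_transpose_simps [simp]:
  "conj_transpose (conj_transpose M) = M"
  "conj_transpose (M + N) = conj_transpose M + conj_transpose N"
  "conj_transpose (M - N) = conj_transpose M - conj_transpose N"
  "conj_transpose (mscale c M) = mscale (cnj c) (conj_transpose M)"
  "conj_transpose 0 = 0"
  "conj_transpose (mat 1) = mat 1"
  "conj_transpose all_ones = all_ones"
  by (simp_all add: conj_transpose_def mscale_def vec_eq_iff mat_def all_ones_def)

lemma conj_transpose_mult: "conj_transpose (M ** N) = conj_transpose N ** conj_transpose M"
  by (simp add: conj_transpose_def matrix_matrix_mult_def vec_eq_iff mult.commute)

lemma mscale_mult_left [simp]: "mscale c M ** N = mscale c (M ** N)"
  and mscale_mult_right [simp]: "M ** mscale c N = mscale c (M ** N)"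
  and mscale_mult_vec [simp]: "mscale c M *v x = c *s (M *v x)"
  and trace_mscale [simp]: "trace (mscale c M) = c * trace M"
  by (simp_all add: mscale_def matrix_matrix_mult_def matrix_vector_mult_def trace_def
      vec_eq_iff sum_distrib_left ac_simps)

section \<open>Positive semidefinite matrices\<close>

text \<open>
  A null vector of the form minimises it, so the first variation there vanishes: moving from
  \<open>x\<close> to \<open>x - s P x\<close> changes the form by
  \<open>- 2 s \<parallel>P x\<parallel>\<^sup>2 + O(s\<^sup>2)\<close>, which is negative for small \<open>s\<close> unless \<open>P x = 0\<close>.
\<close>

lemma psd_kernel:
  assumes "psd P" "cdot x (P *v x) = 0"
  shows "P *v x = 0"
proof -
  define w where "w = P *v x"
  define a where "a = (norm w)\<^sup>2"
  define b where "b = Re (cdot w (P *v w))"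
  have b: "0 \<le> b"
    using psd_cdot_nonneg[OF assms(1), of w] by (simp add: b_def less_eq_complex_def)
  have xw: "cdot x (P *v w) = cdot w w"
    using psd_hermitian[OF assms(1)] by (simp add: cdot_adjoint w_def)
  have "2 * a * s \<le> s\<^sup>2 * b" for s :: real
  proof -
    have "0 \<le> cdot (x - of_real s *s w) (P *v (x - of_real s *s w))"
      by (rule psd_cdot_nonneg[OF assms(1)])
    also have "\<dots> = of_real (s\<^sup>2) * cdot w (P *v w) - of_real (2 * s * a)"
      by (simp add: matrix_vector_mult_diff_distrib vector_scalar_commute cdot_simps assms(2)[folded w_def]
          xw w_def[symmetric] cdot_self a_def power2_eq_square algebra_simps)
    finally show ?thesis
      by (simp add: less_eq_complex_def b_def algebra_simps)
  qed
  note quadratic = this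
  have "a = 0"
  proof (rule ccontr)
    assume "a \<noteq> 0"
    then have a: "0 < a" by (simp add: a_def)
    \<comment> \<open>Small enough for the linear term to dominate; adding 1 covers \<open>b = 0\<close>.\<close>
    define s where "s = a / (b + 1)"
    have s: "0 < s" "s * b \<le> a"
      using a b by (simp_all add: s_def field_simps)
    have "s * (2 * a) \<le> s * (s * b)"
      using quadratic[of s] by (simp add: power2_eq_square ac_simps)
    with s a show False by simp
  qed
  then show ?thesis
    by (simp add: a_def w_def)
qed

lemma psd_congruence:
  assumes "psd P"
  shows "psd (X ** P ** conj_transpose X)"
  unfolding psd_iff_cdot
proof safe
  show "conj_transpose (X ** P ** conj_transpose X) = X ** P ** conj_transpose X"
    by (simp add: conj_transpose_mult psd_hermitian[OF assms] matrix_mul_assoc)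
  fix x
  have "cdot x ((X ** P ** conj_transpose X) *v x) =
      cdot (conj_transpose X *v x) (P *v (conj_transpose X *v x))"
    by (simp add: matrix_vector_mul_assoc[symmetric] cdot_adjoint[of x X])
  then show "0 \<le> cdot x ((X ** P ** conj_transpose X) *v x)"
    using psd_cdot_nonneg[OF assms] by simp
qed

lemma cdot_axis: "cdot (axis i 1) x = x $ i"
proof -
  have "cdot (axis i 1) x = (\<Sum>k\<in>UNIV. if k = i then x $ k else 0)"
    unfolding cdot_def by (intro sum.cong) (auto simp: axis_def)
  then show ?thesis by simp
qed

lemma mult_axis: "P *v axis i 1 = column i P"
proof -
  have "(\<Sum>k\<in>UNIV. P $ j $ k * axis i 1 $ k) = (\<Sum>k\<in>UNIV. if k = i then P $ j $ k else 0)" for j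
    by (intro sum.cong) (auto simp: axis_def)
  then show ?thesis by (simp add: matrix_vector_mult_def vec_eq_iff column_def)
qed

lemma psd_diag_nonneg: "psd P \<Longrightarrow> 0 \<le> P $ i $ i"
  using psd_cdot_nonneg[of P "axis i 1"] by (simp add: cdot_axis mult_axis column_def)

lemma psd_diag_eq_0:
  assumes "psd P" "P $ i $ i = 0"
  shows "P $ k $ i = 0" "P $ i $ k = 0"
proof -
  have "P *v axis i 1 = 0"
    using assms by (intro psd_kernel) (simp_all add: cdot_axis mult_axis column_def)
  then show 1: "P $ k $ i = 0" for k
    by (simp add: mult_axis column_def vec_eq_iff)
  have "P $ i $ k = conj_transpose P $ i $ k"
    using psd_hermitian[OF assms(1)] by simp
  then show "P $ i $ k = 0"
    by (simp add: conj_transpose_def 1)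
qed

lemma psd_eq_0_if_diag_eq_0: "psd P \<Longrightarrow> (\<And>i. P $ i $ i = 0) \<Longrightarrow> P = 0"
  using psd_diag_eq_0(1) by (auto simp: vec_eq_iff)

lemma psd_trace_pos:
  assumes "psd P" "P \<noteq> 0"
  shows "0 < trace P"
proof -
  have "0 \<le> trace P"
    unfolding trace_def by (intro sum_nonneg psd_diag_nonneg assms)
  moreover have "trace P \<noteq> 0"
    using psd_eq_0_if_diag_eq_0[OF assms(1)] assms(2)
    by (auto simp: trace_def sum_nonneg_eq_0_iff psd_diag_nonneg[OF assms(1)])
  ultimately show ?thesis by simp
qed

lemma trace_gram:
  "trace (P ** (R ** conj_transpose R)) = (\<Sum>k\<in>UNIV. cdot (column k R) (P *v column k R))"
proof -
  have "trace (P ** (R ** conj_transpose R)) = trace (conj_transpose R ** (P ** R))"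
    by (simp only: matrix_mul_assoc[of P] trace_mul_sym[of "P ** R"])
  also have "\<dots> = (\<Sum>k\<in>UNIV. cdot (column k R) (P *v column k R))"
    by (simp add: trace_def matrix_matrix_mult_def conj_transpose_def cdot_def column_def
        matrix_vector_mult_def)
  finally show ?thesis .
qed

lemma trace_gram_nonneg: "psd P \<Longrightarrow> 0 \<le> trace (P ** (R ** conj_transpose R))"
  unfolding trace_gram by (intro sum_nonneg psd_cdot_nonneg)

text \<open>
  Symmetric Gaussian elimination. At a pivot \<open>q = Q\<^sub>i\<^sub>i \<noteq> 0\<close>, subtracting the rank one matrix
  formed from column \<open>i\<close>, divided by \<open>q\<close>, leaves the matrix \<open>X Q X\<^sup>*\<close>, where \<open>X\<close> clears
  column \<open>i\<close>. It is still positive semidefinite by congruence, and its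
  row and column \<open>i\<close> vanish. The clause on zero
  columns keeps column \<open>i\<close> of the factor of the remainder free, so that the pivot column
  can be stored there.
\<close>

lemma psd_gram:
  assumes "psd Q"
  shows "\<exists>R. Q = R ** conj_transpose R \<and> (\<forall>i. Q $ i $ i = 0 \<longrightarrow> column i R = 0)"
  using assms
proof (induction "card {i. Q $ i $ i \<noteq> 0}" arbitrary: Q rule: less_induct)
  case less
  show ?case
  proof (cases "\<exists>i. Q $ i $ i \<noteq> 0")
    case False
    then have "Q = 0"
      using psd_eq_0_if_diag_eq_0[OF less.prems] by blast
    then show ?thesis
      by (intro exI[of _ 0]) (simp add: column_def vec_eq_iff)
  next
    case True
    then obtain i where i: "Q $ i $ i \<noteq> 0" by blast
    define q where "q = Q $ i $ i"
    have q: "q \<noteq> 0" "cnj q = q" "0 \<le> q"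
      using i psd_diag_nonneg[OF less.prems, of i]
      by (simp_all add: q_def less_eq_complex_def complex_eq_iff)
    have herm: "cnj (Q $ j $ k) = Q $ k $ j" for j k
      using psd_hermitian[OF less.prems] by (auto simp: conj_transpose_def vec_eq_iff)
    define X :: "complex^'a^'a" where
      "X = (\<chi> j k. (if j = k then 1 else 0) - (if k = i then Q $ j $ i / q else 0))"
    define Q1 where "Q1 = (\<chi> j k. Q $ j $ k - Q $ j $ i * Q $ i $ k / q)"
    have XQ: "X ** Q = Q1"
      by (simp add: X_def Q1_def matrix_matrix_mult_def vec_eq_iff left_diff_distrib sum_subtractf
          if_distrib[of "\<lambda>c. c * _"] cong: if_cong)
    have "Q1 ** conj_transpose X = Q1"
      using q by (simp add: X_def Q1_def conj_transpose_def matrix_matrix_mult_def vec_eq_iff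
          right_diff_distrib sum_subtractf if_distrib[of cnj] if_distrib[of "\<lambda>c. _ * c"] q_def[symmetric]
          cong: if_cong)
    then have psd1: "psd Q1"
      using psd_congruence[OF less.prems, of X] by (simp add: XQ)
    have zero: "Q1 $ j $ j = 0" if "Q $ j $ j = 0" for j
      using psd_diag_eq_0[OF less.prems that] that by (simp add: Q1_def)
    have zero_i: "Q1 $ i $ i = 0"
      using q by (simp add: Q1_def q_def)
    have "{j. Q1 $ j $ j \<noteq> 0} \<subset> {j. Q $ j $ j \<noteq> 0}"
      using zero zero_i i by blast
    then have "card {j. Q1 $ j $ j \<noteq> 0} < card {j. Q $ j $ j \<noteq> 0}"
      by (intro psubset_card_mono) simp_all
    from less.hyps[OF this psd1] obtain R1 where R1: "Q1 = R1 ** conj_transpose R1"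
      "\<And>j. Q1 $ j $ j = 0 \<Longrightarrow> column j R1 = 0"
      by blast
    define s where "s = complex_of_real (sqrt (Re q))"
    have s: "s * s = q" "cnj s = s" "s \<noteq> 0"
      using q by (auto simp: s_def complex_eq_iff less_eq_complex_def)
    define R where "R = (\<chi> j k. if k = i then Q $ j $ i / s else R1 $ j $ k)"
    have R1i: "R1 $ j $ i = 0" for j
      using R1(2)[OF zero_i] by (simp add: column_def vec_eq_iff)
    have "Q = R ** conj_transpose R"
    proof (simp add: vec_eq_iff, intro allI)
      fix j k
      have "(R ** conj_transpose R) $ j $ k = (\<Sum>l\<in>UNIV. R $ j $ l * cnj (R $ k $ l))"
        by (simp add: matrix_matrix_mult_def conj_transpose_def)
      also have "\<dots> = (\<Sum>l\<in>UNIV. R1 $ j $ l * cnj (R1 $ k $ l) +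
          (if l = i then Q $ j $ i * Q $ i $ k / q else 0))"
        using s by (intro sum.cong) (auto simp: R_def R1i herm)
      also have "\<dots> = Q1 $ j $ k + Q $ j $ i * Q $ i $ k / q"
        by (simp add: sum.distrib R1(1) matrix_matrix_mult_def conj_transpose_def)
      finally show "Q $ j $ k = (R ** conj_transpose R) $ j $ k"
        by (simp add: Q1_def)
    qed
    moreover have "column j R = 0" if "Q $ j $ j = 0" for j
    proof -
      have "j \<noteq> i" using that i by auto
      then show ?thesis
        using R1(2)[OF zero[OF that]] by (simp add: R_def column_def vec_eq_iff)
    qed
    ultimately show ?thesis by blast
  qed
qed

text \<open>
  With \<open>Q = R R\<^sup>*\<close> the trace of \<open>P Q\<close> is the sum of the values of the form of \<open>P\<close> on the
  columns of \<open>R\<close>; if it vanishes, \<open>P\<close> annihilates each of these columns.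
\<close>

lemma psd_trace_mult:
  assumes "psd P" "psd Q"
  shows psd_trace_mult_nonneg: "0 \<le> trace (P ** Q)"
    and psd_trace_mult_eq_0: "trace (P ** Q) = 0 \<longleftrightarrow> P ** Q = 0"
proof -
  obtain R where R: "Q = R ** conj_transpose R"
    using psd_gram[OF assms(2)] by (elim exE conjE)
  show "0 \<le> trace (P ** Q)"
    using trace_gram_nonneg[OF assms(1)] by (simp add: R)
  show "trace (P ** Q) = 0 \<longleftrightarrow> P ** Q = 0"
  proof
    assume "trace (P ** Q) = 0"
    then have "cdot (column k R) (P *v column k R) = 0" for k
      unfolding R trace_gram by (simp add: sum_nonneg_eq_0_iff psd_cdot_nonneg[OF assms(1)])
    then have "P *v column k R = 0" for k
      by (rule psd_kernel[OF assms(1)])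
    then have "P ** R = 0"
      by (simp add: vec_eq_iff matrix_vector_mult_def matrix_matrix_mult_def column_def)
    then show "P ** Q = 0"
      by (simp add: R matrix_mul_assoc)
  qed (simp add: trace_def)
qed

text \<open>
  The eigenvalue is the minimum \<open>\<theta>\<close> of the Rayleigh quotient, attained at a unit vector by
  compactness: the minimiser is a null vector of the positive semidefinite matrix
  \<open>H - \<theta> I\<close> and so lies in its kernel.
\<close>

lemma hermitian_not_psd_eigenvector:
  fixes H :: "complex^'n^'n"
  assumes "conj_transpose H = H" "\<not> psd H"
  shows "\<exists>\<theta> v. \<theta> < (0::real) \<and> v \<noteq> 0 \<and> H *v v = complex_of_real \<theta> *s v"
proof -
  have real: "cdot x (H *v x) = of_real (Re (cdot x (H *v x)))" for x
  proof -
    have "cnj (cdot x (H *v x)) = cdot x (H *v x)"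
      unfolding cnj_cdot using cdot_adjoint[of x H x] assms(1) by simp
    then show ?thesis
      by (metis Reals_cnj_iff of_real_Re)
  qed
  have "continuous_on (sphere 0 1) (\<lambda>x. Re (cdot x (H *v x)))"
    unfolding cdot_def matrix_vector_mult_def by (intro continuous_intros)
  moreover have "sphere (0::complex^'n) 1 \<noteq> {}" by simp
  ultimately obtain v where "v \<in> sphere 0 1"
    and v_min: "\<forall>x\<in>sphere 0 1. Re (cdot v (H *v v)) \<le> Re (cdot x (H *v x))"
    using continuous_attains_inf[OF compact_sphere] by fast
  then have v: "norm v = 1" by simp
  define \<theta> where "\<theta> = Re (cdot v (H *v v))"
  have ray: "\<theta> * (norm x)\<^sup>2 \<le> Re (cdot x (H *v x))" for x
  proof (cases "x = 0")
    case False
    define u where "u = complex_of_real (1 / norm x) *s x"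
    have x: "x = complex_of_real (norm x) *s u"
      using False by (simp add: u_def vec_eq_iff)
    have "norm x = norm x * norm u"
      using False by (subst (1) x) (simp add: norm_vec_def L2_set_right_distrib norm_mult)
    then have "norm u = 1" using False by simp
    with v_min have "Re (cdot v (H *v v)) \<le> Re (cdot u (H *v u))" by simp
    then have "\<theta> * (norm x)\<^sup>2 \<le> Re (cdot u (H *v u)) * (norm x)\<^sup>2"
      unfolding \<theta>_def by (rule mult_right_mono) simp
    also have "\<dots> = Re (cdot x (H *v x))"
      by (subst (2 3) x) (simp add: vector_scalar_commute cdot_simps power2_eq_square)
    finally show ?thesis .
  qed (simp add: cdot_simps)
  define P where "P = H - mscale (of_real \<theta>) (mat 1)"
  have P: "cdot x (P *v x) = of_real (Re (cdot x (H *v x)) - \<theta> * (norm x)\<^sup>2)" for x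
    unfolding P_def matrix_vector_mult_diff_rdistrib cdot_simps of_real_diff real[symmetric]
    by (simp add: cdot_simps cdot_self)
  have "psd P"
    unfolding psd_iff_cdot P using ray
    by (simp add: P_def assms(1) less_eq_complex_def)
  moreover have "cdot v (P *v v) = 0"
    unfolding P by (simp add: \<theta>_def v)
  ultimately have "P *v v = 0" by (rule psd_kernel)
  then have "H *v v = complex_of_real \<theta> *s v"
    by (simp add: P_def matrix_vector_mult_diff_rdistrib)
  moreover have "\<theta> < 0"
  proof (rule ccontr)
    assume "\<not> \<theta> < 0"
    then have "0 \<le> Re (cdot x (H *v x))" for x
      using order.trans[OF _ ray[of x]] by (simp add: not_less)
    then have "psd H"
      unfolding psd_iff_cdot using assms(1) by (subst real) (simp add: less_eq_complex_def)
    then show False using assms(2) by simp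
  qed
  moreover have "v \<noteq> 0" using v by auto
  ultimately show ?thesis by blast
qed

section \<open>Eigenvalues inside a matrix algebra\<close>

lemma matrix_add_rdistrib: "((A :: complex^'n^'m) + B) ** C = A ** C + B ** C"
  and matrix_sub_rdistrib: "((A :: complex^'n^'m) - B) ** C = A ** C - B ** C"
  and matrix_sub_ldistrib: "(D :: complex^'n^'m) ** (E - F) = D ** E - D ** F"
  by (simp_all add: matrix_matrix_mult_def vec_eq_iff sum.distrib sum_subtractf algebra_simps)

text \<open>
  A finite-dimensional algebra sees every eigenvalue of its elements. If left multiplication
  by \<open>K = H - \<theta> I\<close> were injective on \<open>S\<close>, it would also be surjective, so \<open>K\<close> would have
  a right inverse and be invertible, although it annihilates \<open>v\<close>. The matrix \<open>X\<close> plays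
  the part of the spectral idempotent of \<open>H\<close> for \<open>\<theta>\<close>.
\<close>

lemma eigenvalue_in_subalgebra:
  fixes S :: "(complex^'n^'n) set"
  assumes sub: "cmat.subspace S" and mult: "\<And>X Y. X \<in> S \<Longrightarrow> Y \<in> S \<Longrightarrow> X ** Y \<in> S"
    and one: "mat 1 \<in> S" and H: "H \<in> S"
    and v: "v \<noteq> 0" "H *v v = \<theta> *s v"
  shows "\<exists>X\<in>S. X \<noteq> 0 \<and> H ** X = mscale \<theta> X"
proof (rule ccontr)
  assume none: "\<not> ?thesis"
  define K where "K = H - mscale \<theta> (mat 1)"
  have K: "K \<in> S"
    unfolding K_def by (intro cmat.subspace_diff cmat.subspace_scale sub H one)
  have scaleR: "c *\<^sub>R X = mscale (of_real c) X" for c and X :: "complex^'n^'n"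
    by (simp add: mscale_def vec_eq_iff scaleR_conv_of_real[where 'a = complex])
  have real_sub: "subspace S"
    using sub by (simp add: subspace_def cmat.subspace_def scaleR)
  have lin: "linear ((**) K :: complex^'n^'n \<Rightarrow> complex^'n^'n)"
    by (rule linearI) (simp_all only: matrix_add_ldistrib scaleR mscale_mult_right)
  have K_mult: "K ** X = H ** X - mscale \<theta> X" for X :: "complex^'n^'n"
    by (simp add: K_def matrix_sub_rdistrib)
  have "inj_on ((**) K) S"
  proof (rule inj_onI)
    fix X Y assume XY: "X \<in> S" "Y \<in> S" "K ** X = K ** Y"
    then have "K ** (X - Y) = 0"
      by (simp add: matrix_sub_ldistrib)
    then have "H ** (X - Y) = mscale \<theta> (X - Y)"
      by (simp add: K_mult)
    moreover have "X - Y \<in> S"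
      using XY by (intro cmat.subspace_diff sub)
    ultimately show "X = Y"
      using none by auto
  qed
  then have "dim ((**) K ` S) = dim S"
    using lin by (intro dim_image_eq) (simp_all add: span_eq_iff[THEN iffD2, OF real_sub])
  moreover have "(**) K ` S \<subseteq> S"
    using mult K by blast
  ultimately have "(**) K ` S = S"
    using linear_subspace_image[OF lin real_sub] real_sub by (intro subspace_dim_equal) simp_all
  then obtain Y where "K ** Y = mat 1"
    using one by (metis imageE)
  then have "Y ** K = mat 1"
    using matrix_left_right_inverse by blast
  then have "v = Y *v (K *v v)"
    by (simp add: matrix_vector_mul_assoc)
  also have "K *v v = 0"
    by (simp add: K_def matrix_vector_mult_diff_rdistrib v)
  finally show False
    using v by simp
qed

section \<open>Coherent algebras and their orthogonal projections\<close>

lemma mat_inner_self_nonneg: "0 \<le> mat_inner X X"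
  unfolding mat_inner_sum
  by (intro sum_nonneg) (simp add: complex_norm_square[symmetric] less_eq_complex_def)

lemma cnj_mat_inner: "cnj (mat_inner X Y) = mat_inner Y X"
  by (simp add: mat_inner_sum mult.commute)

lemma trace_conj_transpose: "trace (conj_transpose X) = cnj (trace X)"
  by (simp add: trace_def conj_transpose_def)

lemma mat_inner_conj_transpose: "mat_inner (conj_transpose X) Y = cnj (mat_inner X (conj_transpose Y))"
proof -
  have "mat_inner (conj_transpose X) Y = trace (conj_transpose (Y ** X))"
    by (simp only: mat_inner_def conj_transpose_mult)
  also have "\<dots> = cnj (trace (X ** Y))"
    by (simp only: trace_conj_transpose trace_mul_sym[of X])
  finally show ?thesis
    by (simp add: mat_inner_def)
qed

lemma all_ones_mult_all_ones: "all_ones ** all_ones = mscale (of_nat CARD('n)) (all_ones :: complex^'n^'n)"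
  by (simp add: all_ones_def mscale_def matrix_matrix_mult_def vec_eq_iff)

lemma mscale_all_ones_component: "mscale c all_ones $ i $ j = c"
  by (simp add: mscale_def all_ones_def)

lemma trace_all_ones: "trace (all_ones :: complex^'n^'n) = of_nat CARD('n)"
  by (simp add: trace_def all_ones_def)

context
  fixes \<C> :: "(complex^'n^'n) set"
  assumes config: "coherent_configuration \<C>"
begin

lemma config_finite: "finite \<C>"
  and config_entry: "B \<in> \<C> \<Longrightarrow> B $ i $ j = 0 \<or> B $ i $ j = 1"
  and config_sum: "\<Sum>\<C> = all_ones"
  and config_transpose: "B \<in> \<C> \<Longrightarrow> transpose B \<in> \<C>"
  and config_mult: "B \<in> \<C> \<Longrightarrow> C \<in> \<C> \<Longrightarrow> B ** C \<in> cmat.span \<C>"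
  using config unfolding coherent_configuration_def zero_one_matrix_def by auto

lemma config_disjoint:
  assumes "B \<in> \<C>" "C \<in> \<C>" "B \<noteq> C" "B $ i $ j \<noteq> 0"
  shows "C $ i $ j = 0"
proof -
  have nonneg: "0 \<le> B $ k $ l * cnj (C $ k $ l)" for k l
    using config_entry[OF assms(1), of k l] config_entry[OF assms(2), of k l]
    by (auto simp: less_eq_complex_def)
  have "(\<Sum>k\<in>UNIV. \<Sum>l\<in>UNIV. B $ k $ l * cnj (C $ k $ l)) = 0"
    using coherent_configuration_orthogonal[OF config assms(1-3)] by (simp add: mat_inner_sum)
  then have "B $ i $ j * cnj (C $ i $ j) = 0"
    by (simp add: sum_nonneg_eq_0_iff sum_nonneg nonneg)
  then show ?thesis using assms(4) by simp
qed

lemma config_in_algebra: "B \<in> \<C> \<Longrightarrow> B \<in> coherent_algebra \<C>"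
  by (simp add: coherent_algebra_def cmat.span_base)

lemma all_ones_in_algebra: "all_ones \<in> coherent_algebra \<C>"
  unfolding coherent_algebra_def config_sum[symmetric] by (intro cmat.span_sum cmat.span_base)

lemma algebra_mult:
  assumes "X \<in> coherent_algebra \<C>" "Y \<in> coherent_algebra \<C>"
  shows "X ** Y \<in> coherent_algebra \<C>"
proof -
  have *: "B ** Y \<in> cmat.span \<C>" if "B \<in> \<C>" for B
    using assms(2)[unfolded coherent_algebra_def]
  proof (induction rule: cmat.span_induct_alt)
    case (step c C Z)
    then show ?case
      using config_mult[OF that step(1)]
      by (simp add: matrix_add_ldistrib cmat.span_add cmat.span_scale)
  qed (simp add: cmat.span_zero)
  from assms(1) show ?thesis
    unfolding coherent_algebra_def
  proof (induction rule: cmat.span_induct_alt)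
    case (step c B Z)
    then show ?case
      using * by (simp add: matrix_add_rdistrib cmat.span_add cmat.span_scale)
  qed (simp add: cmat.span_zero)
qed

lemma algebra_conj_transpose:
  assumes "X \<in> coherent_algebra \<C>"
  shows "conj_transpose X \<in> coherent_algebra \<C>"
  using assms unfolding coherent_algebra_def
proof (induction rule: cmat.span_induct_alt)
  case (step c B Z)
  have "conj_transpose B = transpose B"
  proof -
    have "cnj (B $ i $ j) = B $ i $ j" for i j
      using config_entry[OF step(1), of i j] by auto
    then show ?thesis
      by (simp add: conj_transpose_def transpose_def)
  qed
  then show ?case
    using step config_transpose[OF step(1)]
    by (simp add: cmat.span_add cmat.span_scale cmat.span_base)
qed (simp add: cmat.span_zero)

lemma orth_proj_mem: "orth_proj (coherent_algebra \<C>) X \<in> coherent_algebra \<C>"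
  and orth_proj_inner: "Z \<in> coherent_algebra \<C> \<Longrightarrow>
    mat_inner (orth_proj (coherent_algebra \<C>) X) Z = mat_inner X Z"
  using theI'[OF ex1_orth_proj[OF config, of X]]
  by (auto simp: orth_proj_def mat_inner_simps)

lemma orth_proj_eqI:
  assumes "Y \<in> coherent_algebra \<C>" "\<And>Z. Z \<in> coherent_algebra \<C> \<Longrightarrow> mat_inner Y Z = mat_inner X Z"
  shows "orth_proj (coherent_algebra \<C>) X = Y"
  unfolding orth_proj_def
  by (rule the1_equality[OF ex1_orth_proj[OF config]]) (simp add: assms mat_inner_simps)

lemma orth_proj_hermitian:
  assumes "conj_transpose M = M"
  shows "conj_transpose (orth_proj (coherent_algebra \<C>) M) = orth_proj (coherent_algebra \<C>) M"
proof (rule orth_proj_eqI[symmetric])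
  let ?Y = "orth_proj (coherent_algebra \<C>) M"
  show "conj_transpose ?Y \<in> coherent_algebra \<C>"
    by (intro algebra_conj_transpose orth_proj_mem)
  fix Z assume "Z \<in> coherent_algebra \<C>"
  then have "mat_inner ?Y (conj_transpose Z) = mat_inner M (conj_transpose Z)"
    by (intro orth_proj_inner algebra_conj_transpose)
  then have "mat_inner (conj_transpose ?Y) Z = mat_inner (conj_transpose M) Z"
    by (simp add: mat_inner_conj_transpose)
  then show "mat_inner (conj_transpose ?Y) Z = mat_inner M Z"
    by (simp add: assms)
qed

text \<open>
  The matrices of the configuration form an orthogonal family, so this is Parseval's identity.
  A zero matrix in the configuration contributes \<open>0 / 0 = 0\<close>.
\<close>

lemma mat_inner_orth_proj:
  "mat_inner (orth_proj (coherent_algebra \<C>) M) (orth_proj (coherent_algebra \<C>) N) =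
    (\<Sum>B\<in>\<C>. mat_inner M B * mat_inner B N / mat_inner B B)"
proof -
  define t where "t B = mat_inner B N / mat_inner B B" for B
  have expand: "mat_inner Y N = (\<Sum>B\<in>\<C>. mat_inner Y B * t B)" if "Y \<in> cmat.span \<C>" for Y
    using that
  proof (induction rule: cmat.span_induct_alt)
    case (step c C Z)
    have "(\<Sum>B\<in>\<C>. mat_inner C B * t B) = (\<Sum>B\<in>\<C>. if B = C then mat_inner C N else 0)"
      using coherent_configuration_orthogonal[OF config step(1)]
      by (intro sum.cong) (auto simp: t_def mat_inner_eq_0_iff mat_inner_simps)
    also have "\<dots> = mat_inner C N"
      using step(1) config_finite by simp
    finally have C: "(\<Sum>B\<in>\<C>. mat_inner C B * t B) = mat_inner C N" .
    have "(\<Sum>B\<in>\<C>. mat_inner (mscale c C + Z) B * t B) =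
        (\<Sum>B\<in>\<C>. c * (mat_inner C B * t B) + mat_inner Z B * t B)"
      by (intro sum.cong) (simp_all add: mat_inner_simps distrib_right)
    also have "\<dots> = c * mat_inner C N + mat_inner Z N"
      by (simp only: sum.distrib sum_distrib_left[symmetric] C step(2))
    finally show ?case
      by (simp add: mat_inner_simps)
  qed (simp add: mat_inner_simps)
  let ?p = "orth_proj (coherent_algebra \<C>)"
  have "mat_inner (?p M) (?p N) = cnj (mat_inner (?p N) (?p M))"
    by (simp add: cnj_mat_inner)
  also have "\<dots> = mat_inner (?p M) N"
    by (simp add: orth_proj_inner orth_proj_mem cnj_mat_inner)
  also have "\<dots> = (\<Sum>B\<in>\<C>. mat_inner (?p M) B * t B)"
    using expand orth_proj_mem unfolding coherent_algebra_def by blast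
  also have "\<dots> = (\<Sum>B\<in>\<C>. mat_inner M B * mat_inner B N / mat_inner B B)"
    by (intro sum.cong)
      (simp_all add: t_def orth_proj_inner config_in_algebra)
  finally show ?thesis .
qed

context
  assumes hom: "homogeneous \<C>"
begin

lemma one_in_algebra: "mat 1 \<in> coherent_algebra \<C>"
  using hom by (simp add: homogeneous_def coherent_algebra_def cmat.span_base)

text \<open>
  By homogeneity the identity is a single class, and all other classes vanish on the diagonal.
\<close>

lemma algebra_constant_diagonal:
  assumes "X \<in> coherent_algebra \<C>"
  shows "X $ i $ i = X $ j $ j"
  using assms unfolding coherent_algebra_def
proof (induction rule: cmat.span_induct_alt)
  case (step c B Z)
  have "B $ i $ i = B $ j $ j"
  proof (cases "B = mat 1")
    case False
    have "mat 1 \<in> \<C>" using hom by (simp add: homogeneous_def)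
    from config_disjoint[OF this step(1)] False show ?thesis
      by (simp add: mat_def)
  qed (simp add: mat_def)
  with step(2) show ?case by (simp add: mscale_def)
qed simp

text \<open>
  The \<open>i\<close>-th row sum of \<open>X\<close> is the \<open>i\<close>-th diagonal entry of \<open>X J\<close>, which belongs to the
  algebra and so has constant diagonal; columns are treated alike with \<open>J X\<close>. Row sums and
  column sums agree because \<open>X J\<close> and \<open>J X\<close> have the same trace.
\<close>

lemma algebra_mult_all_ones:
  assumes "X \<in> coherent_algebra \<C>"
  shows "X ** all_ones = mscale (trace (all_ones ** X) / of_nat CARD('n)) all_ones" (is ?right)
    and "all_ones ** X = mscale (trace (all_ones ** X) / of_nat CARD('n)) all_ones" (is ?left)
proof -
  have const: "(X ** all_ones) $ i $ i = (X ** all_ones) $ j $ j"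
      "(all_ones ** X) $ i $ i = (all_ones ** X) $ j $ j" for i j
    by (intro algebra_constant_diagonal algebra_mult assms all_ones_in_algebra)+
  have diag: "Y $ i $ i = trace Y / of_nat CARD('n)"
    if "\<And>i j. Y $ i $ i = Y $ j $ j" for i and Y :: "complex^'n^'n"
  proof -
    have "trace Y = (\<Sum>j\<in>(UNIV :: 'n set). Y $ i $ i)"
      unfolding trace_def by (rule sum.cong[OF refl]) (rule that)
    then show ?thesis by simp
  qed
  have rows: "(X ** all_ones) $ i $ j = (X ** all_ones) $ i $ i" for i j
    by (simp add: matrix_matrix_mult_def all_ones_def)
  have columns: "(all_ones ** X) $ i $ j = (all_ones ** X) $ j $ j" for i j
    by (simp add: matrix_matrix_mult_def all_ones_def)
  have "(X ** all_ones) $ i $ j = trace (all_ones ** X) / of_nat CARD('n)"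
    "(all_ones ** X) $ i $ j = trace (all_ones ** X) / of_nat CARD('n)" for i j
    using trans[OF rows diag[OF const(1)]] trans[OF columns diag[OF const(2)]]
    unfolding trace_mul_sym[of X] by blast+
  then show ?right ?left
    by (simp_all add: vec_eq_iff mscale_all_ones_component)
qed

text \<open>
  The projection \<open>H\<close> of \<open>M\<close> has the same inner products as \<open>M\<close> with all \<open>X X\<^sup>*\<close>, where \<open>X\<close>
  is in the algebra, and those of \<open>M\<close> are nonnegative. A negative eigenvalue \<open>\<theta>\<close> of \<open>H\<close> would
  give a nonzero \<open>X\<close> in the algebra with \<open>H X = \<theta> X\<close>, and then
  \<open>\<langle>H, X X\<^sup>*\<rangle> = \<theta> \<langle>X, X\<rangle> < 0\<close>.
\<close>

lemma orth_proj_psd: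
  assumes "psd M"
  shows "psd (orth_proj (coherent_algebra \<C>) M)"
proof (rule ccontr)
  define H where "H = orth_proj (coherent_algebra \<C>) M"
  assume "\<not> psd (orth_proj (coherent_algebra \<C>) M)"
  then obtain \<theta> v where \<theta>: "\<theta> < (0::real)" and v: "v \<noteq> 0" "H *v v = of_real \<theta> *s v"
    using hermitian_not_psd_eigenvector orth_proj_hermitian psd_hermitian[OF assms]
    unfolding H_def by blast
  have "cmat.subspace (coherent_algebra \<C>)"
    by (simp add: coherent_algebra_def cmat.subspace_span)
  from eigenvalue_in_subalgebra[OF this algebra_mult one_in_algebra _ v]
  obtain X where X: "X \<in> coherent_algebra \<C>" "X \<noteq> 0" "H ** X = mscale (of_real \<theta>) X"
    using orth_proj_mem unfolding H_def by blast
  have XX: "X ** conj_transpose X \<in> coherent_algebra \<C>"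
    using X by (intro algebra_mult algebra_conj_transpose)
  have "0 \<le> trace (M ** (X ** conj_transpose X))"
    by (rule trace_gram_nonneg[OF assms])
  also have "\<dots> = mat_inner M (X ** conj_transpose X)"
    by (simp add: mat_inner_def conj_transpose_mult)
  also have "\<dots> = mat_inner H (X ** conj_transpose X)"
    using XX by (simp add: H_def orth_proj_inner)
  also have "\<dots> = of_real \<theta> * mat_inner X X"
    by (simp add: mat_inner_def conj_transpose_mult matrix_mul_assoc X)
  finally have "0 \<le> \<theta> * Re (mat_inner X X)"
    by (simp add: less_eq_complex_def)
  moreover have "0 < Re (mat_inner X X)"
    using mat_inner_self_nonneg[of X] mat_inner_eq_0_iff[of X] X(2)
    by (auto simp: less_eq_complex_def complex_eq_iff)
  ultimately show False
    using \<theta> by (simp add: zero_le_mult_iff)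
qed

text \<open>
  Both matrices act on the all-ones vector by scalars \<open>\<alpha>\<close> and \<open>\<beta>\<close>, and \<open>c = \<alpha> \<beta>\<close> is the
  contribution of that eigenvector to the trace. Removing it from one factor only is enough:
  \<open>P = M - \<alpha> E\<close>, with \<open>E = J / n\<close> the projection onto that vector, is the compression of \<open>M\<close>
  to the orthogonal complement, and \<open>P N = M N - (\<alpha> \<beta> / n) J\<close> has trace
  \<open>tr (M N) - \<alpha> \<beta>\<close>.
\<close>

lemma psd_algebra_trace_mult:
  fixes M N :: "complex^'n^'n"
  defines "c \<equiv> trace (all_ones ** M) * trace (all_ones ** N) / (of_nat CARD('n))\<^sup>2"
  assumes M: "M \<in> coherent_algebra \<C>" "psd M" and N: "N \<in> coherent_algebra \<C>" "psd N"
  shows "c \<le> trace (M ** N)"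
    and "trace (M ** N) = c \<longleftrightarrow> (\<exists>a. M ** N = mscale a all_ones)"
proof -
  define n :: complex where "n = of_nat CARD('n)"
  have n: "n \<noteq> 0" "cnj n = n" by (simp_all add: n_def)
  define \<alpha> where "\<alpha> = trace (all_ones ** M) / n"
  define \<beta> where "\<beta> = trace (all_ones ** N) / n"
  have c: "c = \<alpha> * \<beta>"
    by (simp add: c_def \<alpha>_def \<beta>_def n_def power2_eq_square)
  note MJ = algebra_mult_all_ones[OF M(1), folded n_def, folded \<alpha>_def]
  note NJ = algebra_mult_all_ones[OF N(1), folded n_def, folded \<beta>_def]
  define E :: "complex^'n^'n" where "E = mscale (1 / n) all_ones"
  define P where "P = M - mscale \<alpha> E"
  have EE: "E ** E = E"
    using n by (simp only: E_def mscale_mult_left mscale_mult_right all_ones_mult_all_ones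
        n_def[symmetric] cmat.scale_scale) simp
  have ME: "M ** E = mscale \<alpha> E" and EM: "E ** M = mscale \<alpha> E"
    by (simp_all only: E_def mscale_mult_left mscale_mult_right MJ cmat.scale_scale mult.commute)
  have E_herm: "conj_transpose E = E"
    using n by (simp add: E_def)
  have "(mat 1 - E) ** M ** conj_transpose (mat 1 - E) = P"
    by (simp add: EE ME EM E_herm P_def matrix_sub_ldistrib matrix_sub_rdistrib)
  then have P: "psd P"
    using psd_congruence[OF M(2), of "mat 1 - E"] by simp
  have PN: "P ** N = M ** N - mscale (\<alpha> * \<beta> / n) all_ones"
    by (simp add: P_def E_def matrix_sub_rdistrib NJ)
  have tr: "trace (P ** N) = trace (M ** N) - c"
    using n by (simp add: PN trace_sub trace_all_ones n_def[symmetric] c)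
  show "c \<le> trace (M ** N)"
    using psd_trace_mult_nonneg[OF P N(2)] by (simp add: tr)
  have "trace (M ** N) = c \<longleftrightarrow> M ** N = mscale (\<alpha> * \<beta> / n) all_ones"
    using psd_trace_mult_eq_0[OF P N(2)] unfolding tr unfolding PN by simp
  also have "\<dots> \<longleftrightarrow> (\<exists>a. M ** N = mscale a all_ones)"
  proof safe
    fix a assume a: "M ** N = mscale a all_ones"
    \<comment> \<open>Applying both sides to the all-ones matrix identifies the scalar.\<close>
    have "mscale (a * n) all_ones = (M ** N) ** all_ones"
      by (simp add: a all_ones_mult_all_ones n_def)
    also have "\<dots> = mscale (\<alpha> * \<beta>) all_ones"
      by (simp add: matrix_mul_assoc[symmetric] NJ MJ mult.commute)
    finally have "a * n = \<alpha> * \<beta>"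
      by (simp add: mscale_def all_ones_def vec_eq_iff)
    then have "a = \<alpha> * \<beta> / n"
      using n by (simp add: field_simps)
    then show "M ** N = mscale (\<alpha> * \<beta> / n) all_ones"
      using a by simp
  qed blast
  finally show "trace (M ** N) = c \<longleftrightarrow> (\<exists>a. M ** N = mscale a all_ones)" .
qed

end

end

section \<open>The clique-coclique bound\<close>

lemma complex_divide_nonpos_nonneg:
  fixes x y :: complex
  assumes "x \<le> 0" "0 \<le> y"
  shows "x / y \<le> 0"
proof -
  have "x = of_real (Re x)" "y = of_real (Re y)"
    using assms by (simp_all add: less_eq_complex_def complex_eq_iff)
  then have "x / y = of_real (Re x / Re y)"
    by (metis of_real_divide)
  then show ?thesis
    using assms by (simp add: less_eq_complex_def divide_nonpos_nonneg)
qed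

theorem theorem7:
  fixes G :: "'n::finite pair_pre_digraph"
    and A\<^sub>s :: "nat \<Rightarrow> complex^'n^'n" and d :: nat
    and M N :: "complex^'n^'n"
  defines "A \<equiv> adjacency_matrix G"
  defines "A_bar \<equiv> all_ones - mat 1 - A"
  defines "\<A> \<equiv> coherent_algebra (A\<^sub>s ` {..d})"
  defines "M' \<equiv> orth_proj \<A> M"
    and "N' \<equiv> orth_proj \<A> N"
  defines "cond_A \<equiv> M \<odot> A = 0 \<and> N \<odot> A_bar = 0"
    and "cond_B \<equiv> M \<odot> A \<le> 0 \<and> N \<odot> A_bar = 0 \<and> N \<odot> A \<ge> 0"
  assumes "pair_graph G" "pverts G = UNIV" "Digraph_Component.connected (with_proj G)"
    and "coherent_configuration (A\<^sub>s ` {..d})" "homogeneous (A\<^sub>s ` {..d})"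
    and "inj_on A\<^sub>s {..d}" "A\<^sub>s 0 = mat 1"
    and "belongs_to G (A\<^sub>s ` {..d})"
    and "psd M" "M \<noteq> 0" "psd N" "N \<noteq> 0"
    and "cond_A \<or> cond_B"
  shows "of_nat CARD('n) \<ge>
           (trace (all_ones ** M) * trace (all_ones ** N)) / (trace M * trace N) \<and>
         (of_nat CARD('n) =
           (trace (all_ones ** M) * trace (all_ones ** N)) / (trace M * trace N) \<longleftrightarrow>
           (\<exists>c. M' ** N' = mscale c all_ones) \<and>
           (cond_A \<or>
            cond_B \<and> (\<forall>r\<in>{1..d}. mat_inner M (A\<^sub>s r) * mat_inner (A\<^sub>s r) N = 0)))"
proof -
  let ?\<C> = "A\<^sub>s ` {..d}"
  note config = assms(11) and hom = assms(12) and inj = assms(13) and A0 = assms(14)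
  note psd = assms(16) assms(18)
  define n p q where "n = real CARD('n)" and "p = Re (trace M)" and "q = Re (trace N)"
  have tr: "trace M = of_real p" "trace N = of_real q" "0 < p" "0 < q"
    using psd_trace_pos[of M] psd_trace_pos[of N] assms(16-19)
    by (auto simp: p_def q_def less_complex_def complex_eq_iff)
  have n: "0 < n" "of_nat CARD('n) = complex_of_real n" by (simp_all add: n_def)
  define t where "t r = mat_inner M (A\<^sub>s r) * mat_inner (A\<^sub>s r) N" for r
  define R where "R = (\<Sum>r\<in>{1..d}. t r / mat_inner (A\<^sub>s r) (A\<^sub>s r))"
  define ab where "ab = trace (all_ones ** M) * trace (all_ones ** N)"
  have N_herm: "conj_transpose N = N" by (rule psd_hermitian[OF psd(2)])
  have N'_herm: "conj_transpose N' = N'"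
    unfolding N'_def \<A>_def by (rule orth_proj_hermitian[OF config N_herm])

  have traces: "trace (all_ones ** M') = trace (all_ones ** M)"
    "trace (all_ones ** N') = trace (all_ones ** N)"
    using orth_proj_inner[OF config all_ones_in_algebra[OF config]]
    by (simp_all add: M'_def N'_def \<A>_def mat_inner_def trace_mul_sym[of all_ones])

  \<comment> \<open>The class of the identity yields the main term; \<open>R\<close> collects all other classes.\<close>
  have split: "trace (M' ** N') = of_real (p * q / n) + R"
  proof -
    have "trace (M' ** N') = mat_inner M' N'"
      by (simp add: mat_inner_def N'_herm)
    also have "\<dots> = (\<Sum>r\<in>{..d}. t r / mat_inner (A\<^sub>s r) (A\<^sub>s r))"
      unfolding M'_def N'_def \<A>_def mat_inner_orth_proj[OF config] t_def
      by (simp add: sum.reindex[OF inj])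
    also have "{..d} = insert 0 {1..d}" by auto
    also have "(\<Sum>r\<in>insert 0 {1..d}. t r / mat_inner (A\<^sub>s r) (A\<^sub>s r)) =
        t 0 / mat_inner (mat 1 :: complex^'n^'n) (mat 1) + R"
      by (simp add: R_def A0)
    also have "t 0 = of_real (p * q)"
      by (simp add: t_def A0 mat_inner_def N_herm tr)
    also have "mat_inner (mat 1 :: complex^'n^'n) (mat 1) = of_real n"
      by (simp add: mat_inner_def n_def trace_I)
    finally show ?thesis by simp
  qed

  obtain S where S: "S \<subseteq> ?\<C>" "A = \<Sum>S"
    using assms(15) by (auto simp: belongs_to_def A_def)
  have fin_S: "finite S" using S(1) finite_subset by blast
  have A_entry: "A $ i $ j = (if A\<^sub>s r \<in> S then 1 else 0)"
    if "r \<le> d" "A\<^sub>s r $ i $ j \<noteq> 0" for r i j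
  proof -
    have "A $ i $ j = (\<Sum>B\<in>S. B $ i $ j)"
      by (simp add: S(2) sum_component)
    also have "\<dots> = (\<Sum>B\<in>S. if B = A\<^sub>s r then A\<^sub>s r $ i $ j else 0)"
      using S(1) config_disjoint[OF config, of "A\<^sub>s r" _ i j] that by (intro sum.cong) auto
    also have "\<dots> = (if A\<^sub>s r \<in> S then 1 else 0)"
      using fin_S config_entry[OF config, of "A\<^sub>s r" i j] that by auto
    finally show ?thesis .
  qed
  have off_diagonal: "i \<noteq> j" if "r \<in> {1..d}" "A\<^sub>s r $ i $ j \<noteq> 0" for r i j
  proof
    assume "i = j"
    have "A\<^sub>s r \<noteq> A\<^sub>s 0"
      using inj that(1) by (auto simp: inj_on_def)
    then have "A\<^sub>s 0 $ i $ j = 0"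
      using that by (intro config_disjoint[OF config, of "A\<^sub>s r"]) auto
    then show False
      using \<open>i = j\<close> by (simp add: A0 mat_def)
  qed

  have N_inner: "mat_inner (A\<^sub>s r) N = 0" if r: "r \<in> {1..d}" "A\<^sub>s r \<notin> S" for r
  proof -
    have "A\<^sub>s r $ i $ j * cnj (N $ i $ j) = 0" for i j
    proof (cases "A\<^sub>s r $ i $ j = 0")
      case False
      then have "A_bar $ i $ j = 1"
        using A_entry[of r i j] off_diagonal[OF r(1)] r
        by (simp add: A_bar_def all_ones_def mat_def)
      moreover have "(N \<odot> A_bar) $ i $ j = 0"
        using assms(20) by (auto simp: cond_A_def cond_B_def)
      ultimately show ?thesis by (simp add: schur_product_def)
    qed simp
    then show ?thesis
      unfolding mat_inner_sum by (intro sum.neutral ballI)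
  qed
  have A_one: "A $ i $ j = 1" "A\<^sub>s r $ i $ j = 1"
    if "r \<in> {1..d}" "A\<^sub>s r \<in> S" "A\<^sub>s r $ i $ j \<noteq> 0" for r i j
    using A_entry[of r i j] config_entry[OF config, of "A\<^sub>s r" i j] that by auto
  have t_A: "t r = 0" if cond_A and r: "r \<in> {1..d}" for r
  proof (cases "A\<^sub>s r \<in> S")
    case True
    have "M $ i $ j * cnj (A\<^sub>s r $ i $ j) = 0" for i j
    proof (cases "A\<^sub>s r $ i $ j = 0")
      case False
      have "(M \<odot> A) $ i $ j = 0" using that(1) by (simp add: cond_A_def)
      then show ?thesis using A_one[OF r True False] by (simp add: schur_product_def)
    qed simp
    then have "mat_inner M (A\<^sub>s r) = 0"
      unfolding mat_inner_sum by (intro sum.neutral ballI)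
    then show ?thesis by (simp add: t_def)
  next
    case False
    then show ?thesis using N_inner[OF r] by (simp add: t_def)
  qed
  have t_B: "t r \<le> 0" if cond_B and r: "r \<in> {1..d}" for r
  proof (cases "A\<^sub>s r \<in> S")
    case True
    have "M $ i $ j * cnj (A\<^sub>s r $ i $ j) \<le> 0 \<and> 0 \<le> A\<^sub>s r $ i $ j * cnj (N $ i $ j)" for i j
    proof (cases "A\<^sub>s r $ i $ j = 0")
      case False
      have "(M \<odot> A) $ i $ j \<le> 0" "0 \<le> (N \<odot> A) $ i $ j"
        using that(1) by (simp_all add: cond_B_def less_eq_vec_def)
      then show ?thesis
        using A_one[OF r True False] by (simp add: schur_product_def less_eq_complex_def)
    qed simp
    then have "mat_inner M (A\<^sub>s r) \<le> 0" "0 \<le> mat_inner (A\<^sub>s r) N"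
      unfolding mat_inner_sum by (auto intro!: sum_nonpos sum_nonneg)
    then show ?thesis
      unfolding t_def by (rule mult_nonpos_nonneg)
  next
    case False
    then show ?thesis using N_inner[OF r] by (simp add: t_def)
  qed
  have t_nonpos: "t r \<le> 0" if "r \<in> {1..d}" for r
    using assms(20) t_A t_B that by fastforce

  have term_nonneg: "0 \<le> - (t r / mat_inner (A\<^sub>s r) (A\<^sub>s r))" if "r \<in> {1..d}" for r
    using complex_divide_nonpos_nonneg[OF t_nonpos[OF that] mat_inner_self_nonneg] by simp
  have R_eq: "- R = (\<Sum>r\<in>{1..d}. - (t r / mat_inner (A\<^sub>s r) (A\<^sub>s r)))"
    by (simp add: R_def sum_negf)
  have R_nonneg: "0 \<le> - R"
    unfolding R_eq by (rule sum_nonneg) (rule term_nonneg)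
  have "- R = 0 \<longleftrightarrow> (\<forall>r\<in>{1..d}. - (t r / mat_inner (A\<^sub>s r) (A\<^sub>s r)) = 0)"
    unfolding R_eq by (rule sum_nonneg_eq_0_iff) (simp_all only: finite_atLeastAtMost term_nonneg)
  also have "\<dots> \<longleftrightarrow> (\<forall>r\<in>{1..d}. t r = 0)"
    by (auto simp: mat_inner_eq_0_iff t_def mat_inner_simps)
  finally have R_zero: "- R = 0 \<longleftrightarrow> (\<forall>r\<in>{1..d}. t r = 0)" .

  define D where "D = trace (M' ** N') - ab / (of_nat CARD('n))\<^sup>2"
  have proj: "M' \<in> coherent_algebra ?\<C>" "psd M'" "N' \<in> coherent_algebra ?\<C>" "psd N'"
    unfolding M'_def N'_def \<A>_def
    by (intro orth_proj_mem orth_proj_psd config hom psd)+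
  note product = psd_algebra_trace_mult[OF config hom proj, unfolded traces, folded ab_def]
  have D_nonneg: "0 \<le> D"
    using product(1) by (simp add: D_def)
  have D_zero: "D = 0 \<longleftrightarrow> (\<exists>c. M' ** N' = mscale c all_ones)"
    using product(2) by (simp add: D_def)

  \<comment> \<open>The slack in the bound is, up to the positive factor \<open>K\<close>, the sum of the slack \<open>D\<close> in
    the trace inequality and the slack \<open>- R\<close> in the sign condition, so it vanishes exactly when
    both do.\<close>
  define K where "K = n\<^sup>2 / (p * q)"
  have K: "0 < K" using tr n by (simp add: K_def)
  have gap: "of_nat CARD('n) - ab / (trace M * trace N) = of_real K * (D + - R)"
    using n tr by (simp add: D_def split K_def field_simps power2_eq_square)
  have "0 \<le> of_real K * (D + - R)"
    using K D_nonneg R_nonneg by (intro mult_nonneg_nonneg add_nonneg_nonneg) (simp_all add: less_eq_complex_def)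
  then have bound: "ab / (trace M * trace N) \<le> of_nat CARD('n)"
    unfolding gap[symmetric] by simp
  have "of_nat CARD('n) = ab / (trace M * trace N) \<longleftrightarrow> D + - R = 0"
    using gap K by (metis eq_iff_diff_eq_0 mult_eq_0_iff of_real_eq_0_iff order_less_irrefl)
  also have "\<dots> \<longleftrightarrow> D = 0 \<and> - R = 0"
    by (rule add_nonneg_eq_0_iff[OF D_nonneg R_nonneg])
  also have "\<dots> \<longleftrightarrow> (\<exists>c. M' ** N' = mscale c all_ones) \<and>
      (cond_A \<or> cond_B \<and> (\<forall>r\<in>{1..d}. t r = 0))"
    unfolding D_zero R_zero using assms(20) t_A by blast
  finally show ?thesis
    using bound unfolding ab_def t_def by blast
qed

end
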